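(* Let $G$ be a group and $A\leq G$ a subgroup. 1. Let $x,y\in G$. Then $G=AA^{x}A^{y}$ implies $y\in AA^{x}$. Moreover, assuming that $y\in AA^{x}$, the following three conditions are equivalent: (a) $G=AA^{x}A^{y}$. (b) $G=(AzA)(AwA)$ where $z=x^{-1}$ and $w=xy^{-1}$. (c) $G=AA^{x}A=(Ax^{-1}A)(AxA)$. 2. Let $x\in G$. Then: (i) $G=AA^{x}A$ if and only if $Ox$ intersects every orbit of the action of $A$ on $\Omega_{A}$, where $O$ is the unique $A$-orbit on $\Omega_A$ satisfying $Ax^{-1}\in O$. Furthermore, for this same $O$ and for arbitrary $z\in AxA$, $Ox$ intersects every orbit of the action of $A$ on $\Omega_{A}$ if and only if $Oz$ intersects every orbit of the action of $A$ on $\Omega_{A}$. (ii) $G=(AxA)^{2}$ if and only if $G=AA^{x}A^{x^{2}}$.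
   Context: $G$ is an arbitrary (not necessarily finite) group. For $A\le G$ and $x\in G$, $A^{x}:=x^{-1}Ax$. Products of subsets of $G$ are setwise products, and $(AxA)^2=(AxA)(AxA)$. $\Omega_{A}:=\{Ag\mid g\in G\}$ is the set of right cosets of $A$ in $G$; $G$, and hence its subgroup $A$, acts on $\Omega_A$ by right multiplication. For $O\subseteq\Omega_A$ and $g\in G$, $Og:=\{\omega g\mid \omega\in O\}\subseteq \Omega_A$. Two sets intersect each other if their intersection is non-empty. *)

theory Defs
  imports "HOL-Algebra.Algebra"
begin

definition conj_subset :: "[_, 'a set, 'a] \<Rightarrow> 'a set"
  where "conj_subset G A x = inv\<^bsub>G\<^esub> x <#\<^bsub>G\<^esub> A #>\<^bsub>G\<^esub> x"

definition double_coset :: "[_, 'a set, 'a] \<Rightarrow> 'a set"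
  where "double_coset G A x = A #>\<^bsub>G\<^esub> x <#>\<^bsub>G\<^esub> A"

definition translate :: "[_, 'a set set, 'a] \<Rightarrow> 'a set set"
  where "translate G Os g = (\<lambda>\<omega>. \<omega> #>\<^bsub>G\<^esub> g) ` Os"

text \<open>
  The locale \<^locale>\<open>group_action\<close> describes left actions only, whereas right multiplication
  is a right action. As \<^const>\<open>orbits\<close> makes sense for any map, it is applied directly to
  right multiplication; the two lemmas below show that the result is the set of orbits of the
  corresponding left action, in which \<open>a\<close> acts by right multiplication by its inverse.
\<close>

definition coset_orbits :: "[_, 'a set] \<Rightarrow> 'a set set set"
  where "coset_orbits G A =
    orbits (G\<lparr>carrier := A\<rparr>) (rcosets\<^bsub>G\<^esub> A) (\<lambda>a \<omega>. \<omega> #>\<^bsub>G\<^esub> a)"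

definition meets_every_coset_orbit :: "[_, 'a set, 'a set set] \<Rightarrow> bool"
  where "meets_every_coset_orbit G A S \<longleftrightarrow> (\<forall>P \<in> coset_orbits G A. S \<inter> P \<noteq> {})"

lemma (in group) rcoset_mult_closed:
  assumes "subgroup A G" "\<omega> \<in> rcosets A" "g \<in> carrier G"
  shows "\<omega> #> g \<in> rcosets A"
  using assms unfolding RCOSETS_def
  by (auto simp: coset_mult_assoc subgroup.subset)

lemma (in group) rcoset_mult_assoc:
  assumes "subgroup A G" "\<omega> \<in> rcosets A" "g \<in> carrier G" "h \<in> carrier G"
  shows "\<omega> #> g #> h = \<omega> #> (g \<otimes> h)"
  using assms by (simp add: coset_mult_assoc subgroup.rcosets_carrier is_group)

lemma (in group) rcoset_mult_group_action:
  assumes A: "subgroup A G"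
  shows "group_action (G\<lparr>carrier := A\<rparr>) (rcosets A) (\<lambda>a. \<lambda>\<omega>\<in>rcosets A. \<omega> #> inv a)"
proof -
  let ?f = "\<lambda>a. \<lambda>\<omega>\<in>rcosets A. \<omega> #> inv a"
  have c: "a \<in> carrier G" if "a \<in> A" for a
    using A that by (rule subgroup.mem_carrier)
  have sub: "\<omega> \<subseteq> carrier G" if "\<omega> \<in> rcosets A" for \<omega>
    using A that by (simp add: subgroup.rcosets_carrier is_group)
  have bij: "?f a \<in> Bij (rcosets A)" if "a \<in> A" for a
  proof -
    have "bij_betw (?f a) (rcosets A) (rcosets A)"
      by (rule bij_betw_byWitness[where f' = "\<lambda>\<omega>. \<omega> #> a"])
        (use A c[OF that] sub in \<open>auto simp: rcoset_mult_closed rcoset_mult_assoc\<close>)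
    then show ?thesis by (simp add: Bij_def)
  qed
  have hom: "?f \<in> hom (G\<lparr>carrier := A\<rparr>) (BijGroup (rcosets A))"
  proof (rule homI)
    fix a b assume "a \<in> carrier (G\<lparr>carrier := A\<rparr>)" "b \<in> carrier (G\<lparr>carrier := A\<rparr>)"
    then have ab: "a \<in> A" "b \<in> A" by simp_all
    have "?f (a \<otimes> b) = compose (rcosets A) (?f a) (?f b)"
      using A c[OF ab(1)] c[OF ab(2)]
      by (auto simp: compose_def fun_eq_iff rcoset_mult_closed rcoset_mult_assoc inv_mult_group)
    then show "?f (a \<otimes>\<^bsub>G\<lparr>carrier := A\<rparr>\<^esub> b) = ?f a \<otimes>\<^bsub>BijGroup (rcosets A)\<^esub> ?f b"
      using bij ab by (simp add: BijGroup_def)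
  qed (use bij in \<open>simp add: BijGroup_def\<close>)
  show ?thesis
    by (intro group_action.intro group_hom.intro group_hom_axioms.intro
        subgroup_imp_group A group_BijGroup hom)
qed

lemma (in group) coset_orbits_eq_orbits_left_action:
  assumes A: "subgroup A G"
  shows "coset_orbits G A =
    orbits (G\<lparr>carrier := A\<rparr>) (rcosets A) (\<lambda>a. \<lambda>\<omega>\<in>rcosets A. \<omega> #> inv a)"
proof -
  have "{\<omega> #> a | a. a \<in> A} = {\<omega> #> inv a | a. a \<in> A}" for \<omega>
    using A by (metis (no_types, opaque_lifting) inv_inv subgroup.m_inv_closed subgroup.mem_carrier)
  then show ?thesis
    by (auto simp: coset_orbits_def orbits_def orbit_def)
qed

end

theory Submission
  imports Defs
begin

text \<open>
  Since \<open>A\<^sup>x = x\<inverse>Ax\<close>, the product \<open>AA\<^sup>xA\<^sup>y\<close> is the right translate by \<open>y\<close> of the product of the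
  double cosets of \<open>x\<inverse>\<close> and \<open>xy\<inverse>\<close>. A translate of a set is all of \<open>G\<close> exactly if the set is,
  so every condition becomes the equation \<open>G = (AuA)(AvA)\<close> for suitable \<open>u, v\<close>. Part 1 follows
  because \<open>y \<in> AA\<^sup>x\<close> means that \<open>xy\<inverse>\<close> and \<open>x\<close> lie in the same double coset, and part 2(ii) by
  inverting all elements. For part 2(i), \<open>Ag\<close> lies in the \<open>A\<close>-orbit of some element of \<open>Oz\<close>
  exactly if \<open>g \<in> (Ax\<inverse>A)(AzA)\<close>.
\<close>

section \<open>Translates, inverses and products of double cosets\<close>

lemma (in group) r_coset_eq_carrier_iff:
  assumes "S \<subseteq> carrier G" "y \<in> carrier G"
  shows "carrier G = S #> y \<longleftrightarrow> carrier G = S"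
proof -
  have *: "carrier G #> g = carrier G" if "g \<in> carrier G" for g
    using coset_join2[OF that subgroup_self that] .
  have "S #> y #> inv y = S"
    using assms by (simp add: coset_mult_assoc)
  then show ?thesis
    using *[of y] *[of "inv y"] assms by (metis inv_closed)
qed

lemma (in group) set_inv_set_mult:
  assumes "H \<subseteq> carrier G" "K \<subseteq> carrier G"
  shows "set_inv (H <#> K) = set_inv K <#> set_inv H"
  using assms by (force simp: SET_INV_def set_mult_def inv_mult_group subset_iff)

lemma (in group) set_inv_eq_carrier_iff:
  assumes "S \<subseteq> carrier G"
  shows "carrier G = set_inv S \<longleftrightarrow> carrier G = S"
proof -
  have "set_inv (carrier G) = carrier G"
    by (auto simp: SET_INV_def)
  moreover have "set_inv (set_inv S) = S"
    using assms by (force simp: SET_INV_def subset_iff)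
  ultimately show ?thesis by metis
qed

lemma (in group) double_coset_closed:
  assumes "A \<subseteq> carrier G" "x \<in> carrier G"
  shows "double_coset G A x \<subseteq> carrier G"
  unfolding double_coset_def by (intro set_mult_closed r_coset_subset_G assms)

lemma (in group) set_inv_double_coset:
  assumes A: "subgroup A G" and x: "x \<in> carrier G"
  shows "set_inv (double_coset G A x) = double_coset G A (inv x)"
proof -
  have AG: "A \<subseteq> carrier G"
    using A by (rule subgroup.subset)
  have "set_inv A = A"
    using A AG by (auto simp: SET_INV_def subgroup.m_inv_closed)
      (metis inv_inv subgroup.m_inv_closed subsetD)
  moreover have "set_inv {x} = {inv x}"
    by (simp add: SET_INV_def)
  ultimately show ?thesis
    using AG x by (simp add: double_coset_def r_coset_eq_set_mult set_inv_set_mult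
        set_mult_assoc set_mult_closed)
qed

lemma double_coset_mem_iff:
  fixes G (structure)
  shows "g \<in> double_coset G A x \<longleftrightarrow> (\<exists>a\<in>A. \<exists>b\<in>A. g = a \<otimes> x \<otimes> b)"
  by (auto simp: double_coset_def r_coset_def set_mult_def)

text \<open>If z = axb with a and b in A, the outer factors are absorbed by the two copies of A,
  because Aa = A and bA = A.\<close>

lemma (in group) double_coset_cong:
  assumes A: "subgroup A G" and x: "x \<in> carrier G" and z: "z \<in> double_coset G A x"
  shows "double_coset G A z = double_coset G A x"
proof -
  obtain a b where ab: "a \<in> A" "b \<in> A" and zab: "z = a \<otimes> x \<otimes> b"
    using z by (auto simp: double_coset_mem_iff)
  note c = subgroup.mem_carrier[OF A]
  have AG: "A \<subseteq> carrier G"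
    using A by (rule subgroup.subset)
  have "A #> z = A #> a #> x #> b"
    using ab x AG c by (simp add: zab coset_mult_assoc m_assoc)
  also have "A #> a = A"
    using subgroup.rcos_const[OF A is_group ab(1)] .
  finally have "double_coset G A z = A #> x <#> (b <# A)"
    using ab x AG c by (simp add: double_coset_def rcos_assoc_lcos r_coset_subset_G)
  also have "b <# A = A"
    using coset_join3[OF c[OF ab(2)] A ab(2)] .
  finally show ?thesis
    by (simp add: double_coset_def)
qed

text \<open>The two adjacent copies of A in (AuA)(AvA) merge by AA = A, so three elements of A
  suffice as witnesses instead of four.\<close>

lemma (in group) double_coset_mult_mem_iff:
  assumes A: "subgroup A G" and "u \<in> carrier G" "v \<in> carrier G"
  shows "g \<in> double_coset G A u <#> double_coset G A v \<longleftrightarrow>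
    (\<exists>a\<in>A. \<exists>b\<in>A. \<exists>c\<in>A. g = a \<otimes> u \<otimes> b \<otimes> v \<otimes> c)"
proof -
  note c = subgroup.subset[OF A]
  have "double_coset G A u <#> double_coset G A v = A #> u <#> (A <#> A) #> v <#> A"
    using assms c by (simp add: double_coset_def r_coset_eq_set_mult set_mult_assoc set_mult_closed)
  also have "A <#> A = A"
    using A by (rule subgroup_mult_id)
  finally show ?thesis
    by (auto simp: r_coset_def set_mult_def)
qed

section \<open>From products of conjugates to products of double cosets\<close>

text \<open>Both sides are the word A x^-1 A x y^-1 A y, bracketed differently, once the double A in
  the middle is merged.\<close>

lemma (in group) mult_conj_subset_conj_subset:
  assumes A: "subgroup A G" and x: "x \<in> carrier G" and y: "y \<in> carrier G"
  shows "A <#> conj_subset G A x <#> conj_subset G A y =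
    double_coset G A (inv x) <#> double_coset G A (x \<otimes> inv y) #> y"
proof -
  note c = subgroup.subset[OF A]
  \<comment> \<open>Splitting this singleton turns both sides into products of A with single group
    elements, so that associativity of \<open><#>\<close> can regroup the factors.\<close>
  have m: "{x \<otimes> inv y} = {x} <#> {inv y}"
    by (simp add: set_mult_def)
  have "double_coset G A (inv x) <#> double_coset G A (x \<otimes> inv y) #> y =
    A <#> {inv x} <#> (A <#> A) <#> {x} <#> {inv y} <#> A <#> {y}"
    using x y c by (simp add: double_coset_def r_coset_eq_set_mult m set_mult_assoc set_mult_closed)
  also have "A <#> A = A"
    using A by (rule subgroup_mult_id)
  finally show ?thesis
    using x y c by (simp add: conj_subset_def l_coset_eq_set_mult r_coset_eq_set_mult
        set_mult_assoc set_mult_closed)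
qed

text \<open>This is the case y = 1 of \<open>mult_conj_subset_conj_subset\<close>, since A^1 =
  A.\<close>

lemma (in group) mult_conj_subset_mult:
  assumes A: "subgroup A G" and x: "x \<in> carrier G"
  shows "A <#> conj_subset G A x <#> A = double_coset G A (inv x) <#> double_coset G A x"
proof -
  have AG: "A \<subseteq> carrier G"
    using A by (rule subgroup.subset)
  then have "conj_subset G A \<one> = A"
    by (simp add: conj_subset_def lcos_mult_one)
  then show ?thesis
    using mult_conj_subset_conj_subset[OF A x one_closed] AG x
    by (simp add: set_mult_closed double_coset_closed)
qed

lemma (in group) mult_conj_subset_conj_subset_eq_carrier_iff:
  assumes A: "subgroup A G" and x: "x \<in> carrier G" and y: "y \<in> carrier G"
  shows "carrier G = A <#> conj_subset G A x <#> conj_subset G A y \<longleftrightarrow>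
    carrier G = double_coset G A (inv x) <#> double_coset G A (x \<otimes> inv y)"
  unfolding mult_conj_subset_conj_subset[OF assms]
  using subgroup.subset[OF A] x y
  by (intro r_coset_eq_carrier_iff set_mult_closed double_coset_closed) auto

lemma mult_conj_subset_mem_iff:
  fixes G (structure)
  shows "y \<in> A <#> conj_subset G A x \<longleftrightarrow> (\<exists>a\<in>A. \<exists>b\<in>A. y = a \<otimes> (inv x \<otimes> b \<otimes> x))"
  by (auto simp: conj_subset_def l_coset_def r_coset_def set_mult_def)

text \<open>Apply the factorization to y itself: y = p y^-1 d y with p \<in> AA^x and d \<in> A.
  Cancelling y gives 1 = p y^-1 d, hence y = dp, and d is absorbed by the leading A.\<close>

lemma (in group) mem_mult_conj_subset_if_eq_carrier:
  assumes A: "subgroup A G" and x: "x \<in> carrier G" and y: "y \<in> carrier G"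
    and G: "carrier G = A <#> conj_subset G A x <#> conj_subset G A y"
  shows "y \<in> A <#> conj_subset G A x"
proof -
  note c = subgroup.mem_carrier[OF A]
  obtain a b d where abd: "a \<in> A" "b \<in> A" "d \<in> A"
    and eq: "y = a \<otimes> (inv x \<otimes> b \<otimes> x) \<otimes> (inv y \<otimes> d \<otimes> y)"
    using y G by (auto simp: conj_subset_def l_coset_def r_coset_def set_mult_def)
  define p where "p = a \<otimes> (inv x \<otimes> b \<otimes> x)"
  have p: "p \<in> carrier G"
    using abd c x by (simp add: p_def)
  have "\<one> \<otimes> y = p \<otimes> inv y \<otimes> d \<otimes> y"
    using eq p y abd c by (simp add: p_def[symmetric] m_assoc)
  then have "\<one> = p \<otimes> inv y \<otimes> d"
    using p y abd c by (subst (asm) r_cancel) auto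
  \<comment> \<open>A product equal to \<open>\<one>\<close> stays so under cyclic rotation. Two
    uses of \<open>inv_comm\<close> bring \<open>inv y\<close> to the right end.\<close>
  then have "p \<otimes> (inv y \<otimes> d) = \<one>"
    using p y abd c by (simp add: m_assoc)
  then have "(inv y \<otimes> d) \<otimes> p = \<one>"
    by (rule inv_comm) (use p y abd c in auto)
  then have "inv y \<otimes> (d \<otimes> p) = \<one>"
    using p y abd c by (simp add: m_assoc)
  then have "(d \<otimes> p) \<otimes> inv y = \<one>"
    by (rule inv_comm) (use p y abd c in auto)
  then have "inv (inv y) = d \<otimes> p"
    by (rule inv_equality) (use p y abd c in auto)
  then have "y = d \<otimes> p"
    using y by simp
  then have "y = (d \<otimes> a) \<otimes> (inv x \<otimes> b \<otimes> x)"
    using abd c x by (simp add: p_def m_assoc)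
  then show ?thesis
    using abd subgroup.m_closed[OF A] by (auto simp: mult_conj_subset_mem_iff)
qed

text \<open>Inverting y = a x^-1 b x and multiplying by x on the left leaves b^-1 x a^-1. Together
  with \<open>double_coset_cong\<close>, this lets x replace w = xy^-1 in condition (b).\<close>

lemma (in group) mem_double_coset_if_mem_mult_conj_subset:
  assumes A: "subgroup A G" and x: "x \<in> carrier G"
    and y: "y \<in> A <#> conj_subset G A x"
  shows "x \<otimes> inv y \<in> double_coset G A x"
proof -
  note c = subgroup.mem_carrier[OF A]
  obtain a b where ab: "a \<in> A" "b \<in> A" and eq: "y = a \<otimes> (inv x \<otimes> b \<otimes> x)"
    using y by (auto simp: mult_conj_subset_mem_iff)
  have "x \<otimes> inv y = inv b \<otimes> x \<otimes> inv a"
    using ab c x by (simp add: eq inv_mult_group m_assoc[symmetric])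
  then show ?thesis
    using ab subgroup.m_inv_closed[OF A] by (auto simp: double_coset_mem_iff)
qed

section \<open>Orbits of A on its right cosets\<close>

lemma (in group) coset_orbits_eq:
  assumes A: "subgroup A G"
  shows "coset_orbits G A = (\<lambda>g. (\<lambda>a. A #> (g \<otimes> a)) ` A) ` carrier G"
proof -
  have "orbit (G\<lparr>carrier := A\<rparr>) (\<lambda>a \<omega>. \<omega> #> a) (A #> g) = (\<lambda>a. A #> (g \<otimes> a)) ` A"
    if "g \<in> carrier G" for g
  proof -
    have "A #> g #> a = A #> (g \<otimes> a)" if "a \<in> A" for a
      using that \<open>g \<in> carrier G\<close> subgroup.subset[OF A] by (simp add: coset_mult_assoc subsetD)
    then show ?thesis
      by (simp add: orbit_def Setcompr_eq_image)
  qed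
  then have "(\<lambda>\<omega>. orbit (G\<lparr>carrier := A\<rparr>) (\<lambda>a \<omega>. \<omega> #> a) \<omega>) ` (\<lambda>g. A #> g) ` carrier G =
      (\<lambda>g. (\<lambda>a. A #> (g \<otimes> a)) ` A) ` carrier G"
    unfolding image_image by (rule image_cong[OF refl])
  then show ?thesis
    by (simp add: coset_orbits_def orbits_def RCOSETS_def Setcompr_eq_image UNION_singleton_eq_range)
qed

text \<open>Distinct orbits are disjoint, so the orbit through Ag is the explicit set of all cosets
  Aga. Stated as an equation for \<open>Os\<close>, this yields existence and uniqueness at
  once.\<close>

lemma (in group) coset_orbit_unique:
  assumes A: "subgroup A G" and g: "g \<in> carrier G"
  shows "Os \<in> coset_orbits G A \<and> A #> g \<in> Os \<longleftrightarrow> Os = (\<lambda>a. A #> (g \<otimes> a)) ` A"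
proof -
  note c = subgroup.mem_carrier[OF A]
  have AG: "A \<subseteq> carrier G"
    using A by (rule subgroup.subset)
  have "A #> g = A #> (g \<otimes> \<one>)"
    using g by simp
  then have self: "A #> g \<in> (\<lambda>a. A #> (g \<otimes> a)) ` A"
    using subgroup.one_closed[OF A] by (rule image_eqI)
  have orbit_eq: "(\<lambda>a. A #> (h \<otimes> a)) ` A = (\<lambda>a. A #> (g \<otimes> a)) ` A"
    if h: "h \<in> carrier G" and b: "b \<in> A" and eq: "A #> g = A #> (h \<otimes> b)" for h b
  proof -
    \<comment> \<open>From Ag = Ahb, replacing a by ba carries one description of the orbit to the
      other, and a \<mapsto> ba maps A onto itself.\<close>
    have "A #> (g \<otimes> a) = A #> (h \<otimes> (b \<otimes> a))" if "a \<in> A" for a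
      using that b g h c AG eq by (metis coset_mult_assoc m_assoc m_closed)
    then have "(\<lambda>a. A #> (g \<otimes> a)) ` A = (\<lambda>a. A #> (h \<otimes> a)) ` ((\<lambda>a. b \<otimes> a) ` A)"
      by (simp add: image_image)
    also have "(\<lambda>a. b \<otimes> a) ` A = A"
      using coset_join3[OF c[OF b] A b] by (simp add: l_coset_def UNION_singleton_eq_range)
    finally show ?thesis ..
  qed
  show ?thesis
  proof (rule iffI)
    assume "Os \<in> coset_orbits G A \<and> A #> g \<in> Os"
    then obtain h b where "h \<in> carrier G" "b \<in> A" "A #> g = A #> (h \<otimes> b)"
      and "Os = (\<lambda>a. A #> (h \<otimes> a)) ` A"
      unfolding coset_orbits_eq[OF A] by blast
    then show "Os = (\<lambda>a. A #> (g \<otimes> a)) ` A"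
      using orbit_eq by simp
  next
    assume "Os = (\<lambda>a. A #> (g \<otimes> a)) ` A"
    then show "Os \<in> coset_orbits G A \<and> A #> g \<in> Os"
      using self g by (simp add: coset_orbits_eq[OF A])
  qed
qed

text \<open>A common coset of Oz and the orbit of Ah has the form Agbz = Ahd. Solving for h gives h
  = a g b z d^-1 with a, b, d in A, and h runs over all of G.\<close>

lemma (in group) meets_every_coset_orbit_iff:
  assumes A: "subgroup A G" and g: "g \<in> carrier G" and z: "z \<in> carrier G"
  shows "meets_every_coset_orbit G A (translate G ((\<lambda>a. A #> (g \<otimes> a)) ` A) z) \<longleftrightarrow>
    carrier G = double_coset G A g <#> double_coset G A z" (is "?L \<longleftrightarrow> _ = ?D")
proof -
  note c = subgroup.mem_carrier[OF A]
  have AG: "A \<subseteq> carrier G"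
    using A by (rule subgroup.subset)
  have t: "translate G ((\<lambda>a. A #> (g \<otimes> a)) ` A) z = (\<lambda>a. A #> (g \<otimes> a \<otimes> z)) ` A"
    unfolding translate_def image_image
    using c g z AG by (intro image_cong) (auto simp: coset_mult_assoc)
  have "(\<lambda>a. A #> (g \<otimes> a \<otimes> z)) ` A \<inter> (\<lambda>a. A #> (h \<otimes> a)) ` A \<noteq> {} \<longleftrightarrow> h \<in> ?D"
    if h: "h \<in> carrier G" for h
  proof -
    have "A #> (g \<otimes> b \<otimes> z) = A #> (h \<otimes> d) \<longleftrightarrow> (\<exists>a\<in>A. h = a \<otimes> g \<otimes> b \<otimes> z \<otimes> inv d)"
      if "b \<in> A" "d \<in> A" for b d
    proof -
      have "A #> (g \<otimes> b \<otimes> z) = A #> (h \<otimes> d) \<longleftrightarrow> h \<otimes> d \<in> A #> (g \<otimes> b \<otimes> z)"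
        using that c g z h A by (metis m_closed repr_independence repr_independenceD)
      also have "\<dots> \<longleftrightarrow> (\<exists>a\<in>A. h \<otimes> d = a \<otimes> g \<otimes> b \<otimes> z)"
        using that c g z by (auto simp: r_coset_def m_assoc)
      also have "\<dots> \<longleftrightarrow> (\<exists>a\<in>A. h = a \<otimes> g \<otimes> b \<otimes> z \<otimes> inv d)"
        using that c g z h by (intro bex_cong refl) (auto simp: inv_solve_right)
      finally show ?thesis .
    qed
    then have "(\<lambda>a. A #> (g \<otimes> a \<otimes> z)) ` A \<inter> (\<lambda>a. A #> (h \<otimes> a)) ` A \<noteq> {} \<longleftrightarrow>
      (\<exists>b\<in>A. \<exists>d\<in>A. \<exists>a\<in>A. h = a \<otimes> g \<otimes> b \<otimes> z \<otimes> inv d)"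
      by blast
    \<comment> \<open>As d runs over A, so does its inverse.\<close>
    also have "\<dots> \<longleftrightarrow> h \<in> ?D"
      unfolding double_coset_mult_mem_iff[OF A g z]
      by (metis A c inv_inv subgroup.m_inv_closed)
    finally show ?thesis .
  qed
  then have "?L \<longleftrightarrow> carrier G \<subseteq> ?D"
    by (auto simp: meets_every_coset_orbit_def t coset_orbits_eq[OF A] subset_iff)
  moreover have "?D \<subseteq> carrier G"
    using AG g z by (intro set_mult_closed double_coset_closed)
  ultimately show ?thesis by blast
qed

theorem theorem1:
  fixes G (structure) and A :: "'a set"
  assumes "group G" and "subgroup A G"
  shows
    "(\<forall>x \<in> carrier G. \<forall>y \<in> carrier G.
        (carrier G = A <#> conj_subset G A x <#> conj_subset G A y
           \<longrightarrow> y \<in> A <#> conj_subset G A x) \<and>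
        (y \<in> A <#> conj_subset G A x \<longrightarrow>
           (let a = (carrier G = A <#> conj_subset G A x <#> conj_subset G A y);
                b = (let z = inv x; w = x \<otimes> inv y in
                       carrier G = double_coset G A z <#> double_coset G A w);
                c = (carrier G = A <#> conj_subset G A x <#> A \<and>
                     A <#> conj_subset G A x <#> A
                       = double_coset G A (inv x) <#> double_coset G A x)
            in (a \<longleftrightarrow> b) \<and> (b \<longleftrightarrow> c) \<and> (a \<longleftrightarrow> c))))
     \<and>
     (\<forall>x \<in> carrier G.
        (\<exists>!Os. Os \<in> coset_orbits G A \<and> A #> inv x \<in> Os) \<and>
        (\<forall>Os. Os \<in> coset_orbits G A \<and> A #> inv x \<in> Os \<longrightarrow>
           (carrier G = A <#> conj_subset G A x <#> A
              \<longleftrightarrow> meets_every_coset_orbit G A (translate G Os x)) \<and>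
           (\<forall>z \<in> double_coset G A x.
              meets_every_coset_orbit G A (translate G Os x)
                \<longleftrightarrow> meets_every_coset_orbit G A (translate G Os z))) \<and>
        (carrier G = double_coset G A x <#> double_coset G A x
           \<longleftrightarrow> carrier G = A <#> conj_subset G A x <#> conj_subset G A (x [^] (2::nat))))"
proof -
  interpret group G by fact
  note A = \<open>subgroup A G\<close>
  have AG: "A \<subseteq> carrier G"
    using A by (rule subgroup.subset)
  show ?thesis
  proof (intro conjI ballI, goal_cases)
    case (1 x y)
    then show ?case
      using mem_mult_conj_subset_if_eq_carrier[OF A] by blast
  next
    case (2 x y)
    \<comment> \<open>With this equality the right-hand side of (b) is (Ax^-1A)(AxA). The second
      equation in (c) always holds by \<open>mult_conj_subset_mult\<close>, so (b) and (c)
      coincide.\<close>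
    have "double_coset G A (x \<otimes> inv y) = double_coset G A x"
      if "y \<in> A <#> conj_subset G A x"
      using double_coset_cong[OF A 2(1) mem_double_coset_if_mem_mult_conj_subset[OF A 2(1) that]] .
    then show ?case
      using mult_conj_subset_conj_subset_eq_carrier_iff[OF A 2] mult_conj_subset_mult[OF A 2(1)]
      by (simp add: Let_def)
  next
    case (3 x)
    then show ?case
      using coset_orbit_unique[OF A inv_closed[OF 3]] by simp
  next
    case (4 x)
    \<comment> \<open>The orbit condition for z is G = (Ax^-1A)(AzA), which depends on z only
      through its double coset.\<close>
    have "z \<in> carrier G \<and> double_coset G A z = double_coset G A x" if "z \<in> double_coset G A x" for z
      using that double_coset_closed[OF AG 4] double_coset_cong[OF A 4 that] by blast
    then show ?case
      using 4 by (simp add: coset_orbit_unique[OF A] meets_every_coset_orbit_iff[OF A]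
          mult_conj_subset_mult[OF A])
  next
    case (5 x)
    let ?D = "double_coset G A"
    have "inv (x \<otimes> x) = inv x \<otimes> inv x"
      using 5 by (simp add: inv_mult_group)
    \<comment> \<open>For y = x^2 the element w = xy^-1 is x^-1, so both double cosets in the
      criterion for G = AA^xA^y become Ax^-1A.\<close>
    then have x2: "x \<otimes> inv (x [^] (2::nat)) = inv x"
      using 5 by (simp add: numeral_2_eq_2 m_assoc[symmetric])
    \<comment> \<open>Elementwise inversion carries (AxA)^2 to (Ax^-1A)^2 and fixes G as a
      set.\<close>
    have "carrier G = ?D x <#> ?D x \<longleftrightarrow> carrier G = set_inv (?D x <#> ?D x)"
      using AG 5 by (intro set_inv_eq_carrier_iff[symmetric] set_mult_closed double_coset_closed)
    also have "set_inv (?D x <#> ?D x) = ?D (inv x) <#> ?D (inv x)"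
      using AG 5 by (simp add: set_inv_set_mult double_coset_closed set_inv_double_coset[OF A])
    finally show ?case
      using mult_conj_subset_conj_subset_eq_carrier_iff[OF A 5, of "x [^] (2::nat)"] 5
      by (simp add: x2)
  qed
qed

end
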